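(* Let $k\geq 2$ and $q\geq 3$ be integers, and let $(F^{(k)}_{q,n})_{n\geq 2-k}$ be the sequence of $(q,k)$-generalized Fibonacci numbers. Let \[ \Phi_{q,k}(t)=t^k-qt^{k-1}-t^{k-2}-\cdots-t-1, \] let $\gamma_1,\gamma_2,\ldots,\gamma_k$ be the roots of $\Phi_{q,k}(t)$, and let \[ g_{q,k}(x):=\frac{x-1}{(k+1)x^2-(q+1)kx+(q-1)(k-1)}. \] Then: (a) for all integers $n\geq 2-k$, \[ F_{q,n}^{(k)}=\sum_{i=1}^k g_{q,k}(\gamma_i)\gamma_i^n; \] (b) if $\gamma$ denotes the dominant root of $\Phi_{q,k}(t)$, then for all integers $n\geq 2-k$, \[ \left|F^{(k)}_{q,n}-g_{q,k}(\gamma)\gamma^n\right|\leq\frac{1}{q}, \] and moreover, for all integers $n\geq1$, \[ \gamma^{n-2}<\gamma^{n-1}\left(\frac{q-1}{q}\right)<F_{q,n}^{(k)}<\gamma^{n-1}\left(\frac{q+2}{q}\right)<\gamma^{n}. \]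
   Context: For integers $q\geq 1$ and $k\geq 2$, the sequence of $(q,k)$-generalized Fibonacci numbers $(F^{(k)}_{q,n})_{n\geq 2-k}$ is defined by the initial conditions $F^{(k)}_{q,-(k-2)}=F^{(k)}_{q,-(k-3)}=\cdots=F^{(k)}_{q,0}=0$, $F^{(k)}_{q,1}=1$, and the recurrence $F_{q,n}^{(k)}=qF_{q,n-1}^{(k)}+F_{q,n-2}^{(k)}+\cdots+F_{q,n-k}^{(k)}$ for all $n\geq 2$. The dominant root of $\Phi_{q,k}(t)$ is its unique positive real root, which lies in the interval $(q,q+1)$; all other roots of $\Phi_{q,k}$ lie strictly inside the unit circle. *)

theory Defs
  imports Complex_Main "HOL-Computational_Algebra.Polynomial"
begin

(* The sequence is indexed by the integers n \<ge> 2 - k; for n < 2 - k the function below returns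
   the arbitrary value 0, which the recurrence (used for n \<ge> 2 only) never reads. *)
function genfib :: "nat \<Rightarrow> nat \<Rightarrow> int \<Rightarrow> int" where
  "genfib q k n =
     (if n \<le> 0 then 0
      else if n = 1 then 1
      else int q * genfib q k (n - 1) + (\<Sum>j = 2..k. genfib q k (n - int j)))"
  by pat_completeness auto
termination
  by (relation "measure (\<lambda>(q, k, n). nat n)") auto

declare genfib.simps [simp del]

lemma genfib_initial: "genfib q k n = 0" if "2 - int k \<le> n" "n \<le> 0"
  using that by (simp add: genfib.simps)

lemma genfib_1: "genfib q k 1 = 1"
  by (simp add: genfib.simps)

lemma genfib_rec:
  "genfib q k n = int q * genfib q k (n - 1) + (\<Sum>j = 2..k. genfib q k (n - int j))" if "n \<ge> 2"
  using that by (subst genfib.simps) simp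

(* Polymorphic in the field: used over complex for all the roots, over real for the dominant one. *)
definition Phi :: "nat \<Rightarrow> nat \<Rightarrow> 'a::field_char_0 poly" where
  "Phi q k = monom 1 k - monom (of_nat q) (k - 1) - (\<Sum>j<k - 1. monom 1 j)"

definition g :: "nat \<Rightarrow> nat \<Rightarrow> 'a::field_char_0 \<Rightarrow> 'a" where
  "g q k x = (x - 1) /
     ((of_nat k + 1) * x ^ 2 - (of_nat q + 1) * of_nat k * x + (of_nat q - 1) * (of_nat k - 1))"

definition dominant_root :: "nat \<Rightarrow> nat \<Rightarrow> real" where
  "dominant_root q k = (THE x. x > 0 \<and> poly (Phi q k) x = 0)"

end

theory Submission
  imports Defs
begin

text \<open>The Binet formula follows from Euler's identity for the sums of
  \<open>\<gamma>\<^sub>i ^ m / \<Phi>' \<gamma>\<^sub>i\<close> once the roots are known to be simple.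
  The estimates do not use the other roots: dividing the recurrence by \<open>t - \<gamma>\<close> leaves the
  cofactor \<open>t ^ (k - 1) + b\<^sub>1 t ^ (k - 2) + \<dots> + b\<^sub>k\<^sub>-\<^sub>1\<close>
  with \<open>b\<^sub>j = \<gamma>\<^sup>-\<^sup>1 + \<dots> + \<gamma> ^ (j - k)\<close>, positive and decreasing.
  Applied to \<open>F\<close> it yields \<open>\<gamma> ^ (n - 1)\<close>, applied to \<open>F n - g \<gamma> \<gamma> ^ n\<close> it yields
  \<open>0\<close>, and \<open>t - 1\<close> times the cofactor makes every error term a convex combination of the
  preceding ones, so the initial errors bound all of them.\<close>

section \<open>The characteristic polynomial\<close>

lemma poly_Phi:
  "poly (Phi q k) x = x ^ k - of_nat q * x ^ (k - 1) - (\<Sum>j<k - 1. x ^ j)"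
  by (simp add: Phi_def poly_monom poly_sum)

text \<open>The factor \<open>t - 1\<close> telescopes the geometric part of \<open>Phi q k\<close>,
  leaving four terms that are easy to evaluate and differentiate.\<close>

lemma Phi_mult:
  assumes "k \<ge> 2"
  shows "[:-1, 1:] * Phi q k =
    monom 1 (k + 1) - monom (of_nat q + 1) k + monom (of_nat q - 1) (k - 1) + (1 :: 'a::field_char_0 poly)"
proof -
  have geo: "[:-1, 1:] * (\<Sum>j<m. monom 1 j) = monom (1::'a) m - 1" for m
  proof (induction m)
    case (Suc m)
    have "[:-1, 1:] * (\<Sum>j<Suc m. monom 1 j) =
        [:-1, 1:] * (\<Sum>j<m. monom 1 j) + [:-1, 1:] * monom (1::'a) m"
      by (simp only: sum.lessThan_Suc distrib_left)
    also have "[:-1, 1:] * monom (1::'a) m = monom 1 (Suc m) - monom 1 m"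
      by (simp add: monom_Suc)
    finally show ?case by (simp only: Suc.IH) simp
  qed simp
  have "k = Suc (k - 1)" using assms by simp
  then obtain m where m: "k = Suc m" by blast
  have X: "[:-1, 1:] * monom c n = monom c (Suc n) - monom c n" for c :: 'a and n
    by (simp add: monom_Suc)
  have "[:-1, 1:] * Phi q k = (monom 1 (Suc k) - monom 1 k) - (monom (of_nat q) (Suc m) - monom (of_nat q) m)
      - (monom (1::'a) m - 1)"
    by (simp only: Phi_def m diff_Suc_1 right_diff_distrib geo X)
  then show ?thesis
    by (simp add: m flip: add_monom diff_monom)
qed

lemma Phi_root_nonzero:
  fixes x :: "'a::field_char_0"
  assumes k: "k \<ge> 2" and root: "poly (Phi q k) x = 0"
  shows "x \<noteq> 0"
proof
  assume x: "x = 0"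
  obtain m where m: "k = m + 2" using k by (metis add.commute le_Suc_ex)
  have "poly ([:-1, 1:] * Phi q k) x = 1"
    unfolding Phi_mult[OF k] by (simp add: x m poly_monom)
  then show False using root by simp
qed

text \<open>At a root, the product rule for \<open>(t - 1) * Phi q k\<close> loses the term
  containing \<open>Phi\<close> itself. Hence \<open>g q k x\<close> is \<open>x ^ (k - 2)\<close>
  over the derivative there, once both denominators are nonzero.\<close>

lemma pderiv_Phi_at_root:
  fixes x :: "'a::field_char_0"
  assumes k: "k \<ge> 2" and root: "poly (Phi q k) x = 0"
  shows "(x - 1) * poly (pderiv (Phi q k)) x = x ^ (k - 2) *
     ((of_nat k + 1) * x ^ 2 - (of_nat q + 1) * of_nat k * x + (of_nat q - 1) * (of_nat k - 1))"
proof -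
  obtain m where m: "k = m + 2" using k by (metis add.commute le_Suc_ex)
  have "poly (pderiv ([:-1, 1:] * Phi q k)) x = (x - 1) * poly (pderiv (Phi q k)) x"
    using root by (simp only: pderiv_mult) (simp add: pderiv_pCons left_diff_distrib)
  also have "poly (pderiv ([:-1, 1:] * Phi q k)) x = x ^ (k - 2) *
     ((of_nat k + 1) * x ^ 2 - (of_nat q + 1) * of_nat k * x + (of_nat q - 1) * (of_nat k - 1))"
    unfolding Phi_mult[OF k]
    by (simp add: pderiv_add pderiv_diff pderiv_monom poly_monom m algebra_simps power2_eq_square)
  finally show ?thesis by simp
qed

section \<open>Existence and uniqueness of the positive root\<close>

lemma sum_inverse_powers:
  fixes x :: real
  assumes "x > 0"
  shows "(x - 1) * (\<Sum>i = 1..m. (1 / x) ^ i) = 1 - (1 / x) ^ m"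
  using assms by (induction m) (simp_all add: field_simps)

lemma sum_split_first:
  fixes f :: "nat \<Rightarrow> 'a::comm_monoid_add"
  assumes "k \<ge> 2"
  shows "(\<Sum>j = 1..k. f j) = f 1 + (\<Sum>j = 2..k. f j)"
  using assms by (simp add: sum.atLeast_Suc_atMost[of "Suc 0" k] numeral_2_eq_2)

lemma sum_shift_two:
  fixes f :: "nat \<Rightarrow> 'a::comm_monoid_add"
  assumes "k \<ge> 2"
  shows "(\<Sum>j = 1..k - 1. f (Suc j)) = (\<Sum>j = 2..k. f j)"
  using assms sum.shift_bounds_cl_Suc_ivl[of f 1 "k - 1"] by (simp add: numeral_2_eq_2)

text \<open>Division by \<open>x ^ (k - 1)\<close> gives a fixed-point form whose left side
  increases with \<open>x\<close> while its right side does not, so positive roots cannot differ. It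
  also yields \<open>b 1\<close>.\<close>

lemma root_Phi_iff:
  fixes x :: real
  assumes "k \<ge> 2" "x > 0"
  shows "poly (Phi q k) x = 0 \<longleftrightarrow> x = real q + (\<Sum>i = 1..k - 1. (1 / x) ^ i)"
proof -
  obtain m where m: "k = Suc m" using assms by (metis Suc_pred' not_numeral_le_zero not_gr0)
  have "(\<Sum>j<m. x ^ j) = (\<Sum>i = 1..m. x ^ (m - i))"
    by (rule sum.reindex_bij_witness[of _ "\<lambda>i. m - i" "\<lambda>j. m - j"]) auto
  also have "\<dots> = x ^ m * (\<Sum>i = 1..m. (1 / x) ^ i)"
    unfolding sum_distrib_left using assms(2)
    by (intro sum.cong) (auto simp: power_diff power_one_over)
  finally have *: "(\<Sum>j<m. x ^ j) = x ^ m * (\<Sum>i = 1..m. (1 / x) ^ i)" .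
  have "poly (Phi q k) x = x ^ m * (x - real q - (\<Sum>i = 1..k - 1. (1 / x) ^ i))"
    unfolding poly_Phi using * by (simp add: m algebra_simps)
  then show ?thesis using assms(2) by auto
qed

lemma positive_root_unique:
  fixes x y :: real
  assumes k: "k \<ge> 2" and "x > 0" "y > 0" "poly (Phi q k) x = 0" "poly (Phi q k) y = 0"
  shows "x = y"
proof -
  have False if "0 < x" "x < y" "poly (Phi q k) x = 0" "poly (Phi q k) y = 0" for x y :: real
  proof -
    have "(\<Sum>i = 1..k - 1. (1 / y) ^ i) \<le> (\<Sum>i = 1..k - 1. (1 / x) ^ i)"
      using that by (intro sum_mono power_mono) (auto simp: frac_le)
    then show False using that root_Phi_iff[OF k, of x q] root_Phi_iff[OF k, of y q] by linarith
  qed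
  then show ?thesis using assms by (metis linorder_neqE_linordered_idom)
qed

lemma positive_root_exists:
  assumes k: "k \<ge> 2" and q: "q \<ge> 1"
  shows "\<exists>x::real. x > 0 \<and> poly (Phi q k) x = 0"
proof -
  have "poly (Phi q k) (real q) < 0"
  proof -
    have "(\<Sum>j<k - 1. real q ^ j) > 0" using k q by (intro sum_pos) (auto simp: lessThan_empty_iff)
    moreover have "real q ^ k = real q * real q ^ (k - 1)" using k
      by (metis One_nat_def power_eq_if not_numeral_le_zero)
    ultimately show ?thesis by (simp add: poly_Phi)
  qed
  moreover have "poly (Phi q k) (real q + 1) > 0"
  proof -
    let ?x = "real q + 1"
    \<comment> \<open>At \<open>q + 1\<close> the two top terms of the product cancel, and the
      factor \<open>t - 1\<close> is the positive number \<open>q\<close>.\<close>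
    have "poly ([:-1, 1:] * Phi q k) ?x = (real q - 1) * ?x ^ (k - 1) + 1"
      unfolding Phi_mult[OF k] by (simp add: poly_monom)
    also have "\<dots> > 0" using q by (intro add_nonneg_pos mult_nonneg_nonneg) auto
    finally have "real q * poly (Phi q k) ?x > 0" by (simp add: algebra_simps)
    then show ?thesis using q by (simp add: zero_less_mult_iff)
  qed
  ultimately obtain x where "x > real q" "poly (Phi q k) x = 0"
    using poly_IVT_pos[of "real q" "real q + 1" "Phi q k"] by auto
  then show ?thesis by (intro exI[of _ x]) (use q in auto)
qed

lemma dominant_root:
  assumes "k \<ge> 2" "q \<ge> 1"
  shows "dominant_root q k > 0" "poly (Phi q k) (dominant_root q k) = 0"
proof -
  have "\<exists>!x::real. x > 0 \<and> poly (Phi q k) x = 0"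
    using positive_root_exists[OF assms] positive_root_unique[OF assms(1)] by blast
  from theI'[OF this] show "dominant_root q k > 0" "poly (Phi q k) (dominant_root q k) = 0"
    unfolding dominant_root_def by auto
qed

section \<open>The dominant root\<close>

text \<open>The root is abstract because these facts serve twice: for
  \<open>dominant_root q k\<close> and for a hypothetical multiple root.\<close>

locale positive_root =
  fixes q k :: nat and \<gamma> :: real
  assumes k: "k \<ge> 2" and q: "q \<ge> 3" and pos: "\<gamma> > 0" and root: "poly (Phi q k) \<gamma> = 0"
begin

text \<open>For \<open>j \<ge> 1\<close> these are the coefficients of the cofactor
  \<open>Phi q k / (t - \<gamma>) = t ^ (k - 1) + (\<Sum>j = 1..k - 1. b j * t ^ (k - 1 - j))\<close>.\<close>

definition b :: "nat \<Rightarrow> real" where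
  "b j = (\<Sum>i = 1..k - j. (1 / \<gamma>) ^ i)"

lemma b_1: "b 1 = \<gamma> - real q"
  using root_Phi_iff[OF k pos] root by (simp add: b_def)

lemma b_k: "b k = 0"
  by (simp add: b_def)

lemma b_nonneg: "b j \<ge> 0"
  unfolding b_def using pos by (intro sum_nonneg) auto

lemma b_Suc_le: "b (Suc j) \<le> b j"
  unfolding b_def using pos by (intro sum_mono2) auto

lemma root_gt: "\<gamma> > real q"
proof -
  have "b 1 > 0" unfolding b_def using pos k by (intro sum_pos) auto
  then show ?thesis unfolding b_1 by simp
qed

lemma root_gt_3: "\<gamma> > 3"
  using root_gt q by simp

text \<open>Synthetic division: for \<open>j \<ge> 1\<close> this compares the coefficients of
  \<open>t ^ (k - 1 - j)\<close> in \<open>Phi q k\<close> and in \<open>t - \<gamma>\<close> times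
  the cofactor.\<close>

lemma gamma_mult_b:
  assumes "j < k"
  shows "\<gamma> * b j = 1 + b (Suc j)"
proof -
  obtain m where m: "k - j = Suc m" using assms by (metis Suc_diff_Suc)
  then have m': "k - Suc j = m" by simp
  have "(\<gamma> - 1) * (\<gamma> * b j) = \<gamma> * (1 - (1 / \<gamma>) ^ Suc m)"
    unfolding b_def m using sum_inverse_powers[OF pos, of "Suc m"] by (simp only: mult.left_commute)
  also have "\<dots> = (\<gamma> - 1) + (\<gamma> - 1) * (\<Sum>i = 1..m. (1 / \<gamma>) ^ i)"
    unfolding sum_inverse_powers[OF pos, of m] using pos by (simp add: right_diff_distrib)
  also have "\<dots> = (\<gamma> - 1) * (1 + b (Suc j))"
    by (simp add: b_def m' algebra_simps)
  finally show ?thesis using root_gt_3 by simp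
qed

lemma b_le: "b j \<le> 1 / (\<gamma> - 1)"
proof -
  have "(\<gamma> - 1) * b j \<le> 1"
    unfolding b_def using sum_inverse_powers[OF pos] pos by simp
  then show ?thesis using root_gt_3 by (simp add: field_simps)
qed

text \<open>\<open>1 + S\<close> is the value of the cofactor at \<open>\<gamma>\<close>, divided by \<open>\<gamma> ^ (k - 1)\<close>.\<close>

definition S :: real where
  "S = (\<Sum>j = 1..k - 1. b j * (1 / \<gamma>) ^ j)"

lemma S_nonneg: "S \<ge> 0"
  unfolding S_def using pos b_nonneg by (intro sum_nonneg) auto

text \<open>Bounding every \<open>b j\<close> by \<open>1 / (\<gamma> - 1)\<close> leaves the sum
  \<open>b 1\<close>, to which the same bound applies, so
  \<open>S \<le> 1 / (\<gamma> - 1) ^ 2\<close>.\<close>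

lemma S_less: "S < 1 / real q"
proof -
  have "S \<le> (\<Sum>j = 1..k - 1. 1 / (\<gamma> - 1) * (1 / \<gamma>) ^ j)"
    unfolding S_def using pos b_le by (intro sum_mono mult_right_mono) auto
  also have "\<dots> = 1 / (\<gamma> - 1) * b 1"
    by (simp add: b_def sum_distrib_left)
  also have "\<dots> \<le> 1 / (\<gamma> - 1) * (1 / (\<gamma> - 1))"
    using root_gt_3 by (intro mult_left_mono b_le) auto
  also have "\<dots> < 1 / real q"
  proof -
    have "real q < (\<gamma> - 1) * 2" using root_gt root_gt_3 by argo
    also have "\<dots> \<le> (\<gamma> - 1) * (\<gamma> - 1)" using root_gt_3 by (intro mult_left_mono) auto
    finally show ?thesis using q by (simp add: field_simps)
  qed
  finally show ?thesis .
qed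

text \<open>Both sides are \<open>\<gamma> - 1\<close> times the derivative of
  \<open>Phi q k\<close> at \<open>\<gamma>\<close>, divided by \<open>\<gamma> ^ (k - 2)\<close>;
  the proof sums \<open>S\<close> in closed form instead. The factored side is visibly
  positive.\<close>

lemma denominator:
  "(real k + 1) * \<gamma> ^ 2 - (real q + 1) * real k * \<gamma> + (real q - 1) * (real k - 1)
     = \<gamma> * (\<gamma> - 1) * (1 + S)"
proof -
  define r where "r = (1 / \<gamma>) ^ (k - 1)"
  have rk: "(1 / \<gamma>) ^ k = r / \<gamma>" using k by (simp add: r_def power_eq_if)
  have r: "r = 1 - (\<gamma> - 1) * (\<gamma> - real q)"
    using sum_inverse_powers[OF pos, of "k - 1"] b_1 by (simp add: r_def b_def)
  have "(\<gamma> - 1) * S = (\<Sum>j = 1..k - 1. ((\<gamma> - 1) * b j) * (1 / \<gamma>) ^ j)"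
    by (simp add: S_def sum_distrib_left mult.assoc)
  \<comment> \<open>The subtracted term does not depend on \<open>j\<close>, so the sum is
    \<open>b 1\<close> minus \<open>k - 1\<close> copies of it.\<close>
  also have "\<dots> = (\<Sum>j = 1..k - 1. (1 / \<gamma>) ^ j - r / \<gamma>)"
  proof (intro sum.cong refl)
    fix j assume j: "j \<in> {1..k - 1}"
    have "(1 / \<gamma>) ^ (k - j) * (1 / \<gamma>) ^ j = r / \<gamma>"
      using j k rk by (subst power_add[symmetric]) auto
    then show "(\<gamma> - 1) * b j * (1 / \<gamma>) ^ j = (1 / \<gamma>) ^ j - r / \<gamma>"
      using sum_inverse_powers[OF pos, of "k - j"] by (simp only: b_def left_diff_distrib mult_1)
  qed
  also have "\<dots> = \<gamma> - real q - (real k - 1) * (r / \<gamma>)"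
    using b_1 k by (simp add: sum_subtractf b_def of_nat_diff)
  finally have S: "(\<gamma> - 1) * S = \<gamma> - real q - (real k - 1) * (r / \<gamma>)" .
  have "\<gamma> * (\<gamma> - 1) * (1 + S) = \<gamma> * (\<gamma> - 1) + \<gamma> * ((\<gamma> - 1) * S)"
    by (simp add: algebra_simps)
  also have "\<dots> = \<gamma> * (\<gamma> - 1) + \<gamma> * (\<gamma> - real q) - (real k - 1) * r"
    unfolding S using pos by (simp add: algebra_simps)
  finally show ?thesis by (simp add: r algebra_simps power2_eq_square)
qed

lemma g_root: "g q k \<gamma> = 1 / (\<gamma> * (1 + S))"
  unfolding g_def denominator using root_gt_3 by simp

section \<open>Bounds for the sequence and for the error term\<close>

text \<open>As a shift operator, \<open>Phi q k\<close> is \<open>t - \<gamma>\<close> times the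
  cofactor, so the cofactor turns solutions into geometric sequences. Only one index
  \<open>n\<close> is involved because \<open>genfib\<close> breaks the recurrence at
  \<open>n = 1\<close>.\<close>

lemma cofactor_recurrence:
  fixes u :: "int \<Rightarrow> real"
  assumes rec: "u n = real q * u (n - 1) + (\<Sum>j = 2..k. u (n - int j))"
  shows "u n + (\<Sum>j = 1..k - 1. b j * u (n - int j)) =
     \<gamma> * (u (n - 1) + (\<Sum>j = 1..k - 1. b j * u (n - 1 - int j)))"
proof -
  have "(\<Sum>j = 1..k - 1. \<gamma> * b j * u (n - 1 - int j)) =
      (\<Sum>j = 1..k - 1. (1 + b (Suc j)) * u (n - int (Suc j)))"
  proof (intro sum.cong refl)
    fix j assume "j \<in> {1..k - 1}"
    then have "\<gamma> * b j = 1 + b (Suc j)" using k by (intro gamma_mult_b) auto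
    moreover have "n - 1 - int j = n - int (Suc j)" by simp
    ultimately show "\<gamma> * b j * u (n - 1 - int j) = (1 + b (Suc j)) * u (n - int (Suc j))" by metis
  qed
  also have "\<dots> = (\<Sum>j = 2..k. (1 + b j) * u (n - int j))"
    by (rule sum_shift_two[OF k])
  also have "\<dots> = (\<Sum>j = 2..k. u (n - int j)) + (\<Sum>j = 2..k. b j * u (n - int j))"
    by (simp add: algebra_simps sum.distrib)
  also have "(\<Sum>j = 2..k. b j * u (n - int j)) = (\<Sum>j = 1..k. b j * u (n - int j)) - b 1 * u (n - 1)"
    by (simp only: sum_split_first[OF k]) simp
  also have "(\<Sum>j = 1..k. b j * u (n - int j)) = (\<Sum>j = 1..k - 1. b j * u (n - int j))"
    using k b_k by (cases k) auto
  finally have "(\<Sum>j = 1..k - 1. \<gamma> * b j * u (n - 1 - int j)) =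
     (\<Sum>j = 2..k. u (n - int j)) + ((\<Sum>j = 1..k - 1. b j * u (n - int j)) - b 1 * u (n - 1))" .
  moreover have "\<gamma> * (\<Sum>j = 1..k - 1. b j * u (n - 1 - int j)) =
      (\<Sum>j = 1..k - 1. \<gamma> * b j * u (n - 1 - int j))"
    by (simp add: sum_distrib_left mult.assoc)
  ultimately show ?thesis unfolding distrib_left rec b_1 by (simp add: algebra_simps)
qed

text \<open>At \<open>n = 1\<close> the sum meets only the initial zeros, so the value is
  \<open>1\<close>; each further step multiplies it by \<open>\<gamma>\<close>.\<close>

lemma genfib_cofactor:
  assumes "n \<ge> 1"
  shows "real_of_int (genfib q k n) + (\<Sum>j = 1..k - 1. b j * real_of_int (genfib q k (n - int j)))
     = \<gamma> powi (n - 1)"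
  using assms
proof (induction n rule: int_ge_induct)
  case base
  have "(\<Sum>j = 1..k - 1. b j * real_of_int (genfib q k (1 - int j))) = 0"
    by (intro sum.neutral) (auto intro!: genfib_initial)
  then show ?case by (simp add: genfib_1)
next
  case (step n)
  have "real_of_int (genfib q k (n + 1)) = real q * real_of_int (genfib q k (n + 1 - 1))
      + (\<Sum>j = 2..k. real_of_int (genfib q k (n + 1 - int j)))"
    using step.hyps by (subst genfib_rec) auto
  from cofactor_recurrence[of "\<lambda>n. real_of_int (genfib q k n)", OF this] step.IH
  have "real_of_int (genfib q k (n + 1)) + (\<Sum>j = 1..k - 1. b j * real_of_int (genfib q k (n + 1 - int j)))
     = \<gamma> * \<gamma> powi (n - 1)" by simp
  also have "\<dots> = \<gamma> powi n" using pos by (simp add: power_int_minus_left power_int_diff)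
  finally show ?case by simp
qed

lemma root_powi_recurrence:
  "\<gamma> powi n = real q * \<gamma> powi (n - 1) + (\<Sum>j = 2..k. \<gamma> powi (n - int j))"
proof -
  have "(\<Sum>j = 2..k. \<gamma> powi (n - int j)) = (\<Sum>i = 1..k - 1. \<gamma> powi (n - int (Suc i)))"
    by (rule sum_shift_two[OF k, symmetric])
  also have "\<dots> = (\<Sum>i = 1..k - 1. \<gamma> powi (n - 1) * (1 / \<gamma>) ^ i)"
    using pos by (intro sum.cong) (auto simp: power_int_diff power_int_add field_simps)
  also have "\<dots> = \<gamma> powi (n - 1) * b 1"
    by (simp add: b_def sum_distrib_left)
  finally have "real q * \<gamma> powi (n - 1) + (\<Sum>j = 2..k. \<gamma> powi (n - int j)) = \<gamma> powi (n - 1) * \<gamma>"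
    unfolding b_1 by (simp add: algebra_simps)
  then show ?thesis using pos by (simp add: power_int_diff)
qed

text \<open>The right side solves the same recurrence, whose coefficients are nonnegative, and
  majorizes \<open>genfib\<close> for all \<open>n \<le> 1\<close>, including the default zeros
  below \<open>2 - k\<close>.\<close>

lemma genfib_le: "real_of_int (genfib q k n) \<le> \<gamma> powi (n - 1)"
proof (induction "nat n" arbitrary: n rule: less_induct)
  case less
  consider "n \<le> 0" | "n = 1" | "n \<ge> 2" by linarith
  then show ?case
  proof cases
    case 3
    have "real_of_int (genfib q k n) = real q * real_of_int (genfib q k (n - 1))
        + (\<Sum>j = 2..k. real_of_int (genfib q k (n - int j)))"
      using 3 by (subst genfib_rec) auto
    also have "\<dots> \<le> real q * \<gamma> powi (n - 1 - 1) + (\<Sum>j = 2..k. \<gamma> powi (n - int j - 1))"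
      using 3 by (intro add_mono mult_left_mono sum_mono less) auto
    also have "\<dots> = \<gamma> powi (n - 1)"
      using root_powi_recurrence[of "n - 1"] by (simp add: algebra_simps)
    finally show ?thesis .
  qed (use pos in \<open>simp_all add: genfib.simps\<close>)
qed

text \<open>In the cofactor identity, \<open>genfib_le\<close> bounds the terms before
  \<open>n\<close> by \<open>S * \<gamma> powi (n - 1)\<close>, which is less than a
  \<open>q\<close>-th part of the right side.\<close>

lemma genfib_greater:
  assumes "n \<ge> 1"
  shows "\<gamma> powi (n - 1) * ((real q - 1) / real q) < real_of_int (genfib q k n)"
proof -
  have "(\<Sum>j = 1..k - 1. b j * real_of_int (genfib q k (n - int j)))
      \<le> (\<Sum>j = 1..k - 1. b j * \<gamma> powi (n - int j - 1))"
    by (intro sum_mono mult_left_mono genfib_le b_nonneg)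
  also have "\<dots> = (\<Sum>j = 1..k - 1. \<gamma> powi (n - 1) * (b j * (1 / \<gamma>) ^ j))"
    using pos by (intro sum.cong) (auto simp: power_int_diff power_one_over field_simps power_int_add)
  also have "\<dots> = \<gamma> powi (n - 1) * S"
    by (simp add: S_def sum_distrib_left)
  also have "\<dots> < \<gamma> powi (n - 1) * (1 / real q)"
    using S_less pos by (intro mult_strict_left_mono) auto
  finally have "\<gamma> powi (n - 1) - \<gamma> powi (n - 1) * (1 / real q) < real_of_int (genfib q k n)"
    using genfib_cofactor[OF assms] by linarith
  then show ?thesis using q by (simp add: field_simps)
qed

text \<open>At \<open>n = 1\<close> the error is \<open>S / (1 + S)\<close>; for
  \<open>n \<le> 0\<close> the sequence vanishes and the error is at most
  \<open>g q k \<gamma> \<le> 1 / \<gamma>\<close>.\<close>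

lemma genfib_approx_initial:
  assumes "n \<le> 1"
  shows "\<bar>real_of_int (genfib q k n) - g q k \<gamma> * \<gamma> powi n\<bar> \<le> 1 / real q"
proof (cases "n = 1")
  case True
  have "\<gamma> * g q k \<gamma> = 1 / (1 + S)" using pos S_nonneg by (simp add: g_root)
  then have "real_of_int (genfib q k n) - g q k \<gamma> * \<gamma> powi n = S / (1 + S)"
    using S_nonneg by (simp add: True genfib_1 field_simps)
  moreover have "S / (1 + S) \<le> S" using S_nonneg by (simp add: field_simps)
  ultimately show ?thesis using S_nonneg S_less by simp
next
  case False
  then have n: "n \<le> 0" using assms by simp
  have "\<gamma> powi n \<le> 1" using power_int_increasing[of n 0 \<gamma>] n root_gt_3 by simp
  moreover have g_nonneg: "g q k \<gamma> \<ge> 0" using pos S_nonneg by (simp add: g_root)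
  ultimately have "g q k \<gamma> * \<gamma> powi n \<le> g q k \<gamma>" by (metis mult_left_mono mult.right_neutral)
  also have "\<dots> \<le> 1 / real q"
  proof -
    have "real q * 1 \<le> \<gamma> * (1 + S)" using root_gt S_nonneg by (intro mult_mono) auto
    then show ?thesis unfolding g_root using q by (intro divide_left_mono) auto
  qed
  finally show ?thesis using g_nonneg n pos by (simp add: genfib.simps)
qed

text \<open>The error term is annihilated by \<open>Phi q k / (t - \<gamma>)\<close>. Multiplying this cofactor by \<open>t - 1\<close>
  expresses each error term as a convex combination of the \<open>k\<close> preceding ones.\<close>

lemma genfib_approx: "\<bar>real_of_int (genfib q k n) - g q k \<gamma> * \<gamma> powi n\<bar> \<le> 1 / real q"
proof -
  define E where "E n = real_of_int (genfib q k n) - g q k \<gamma> * \<gamma> powi n" for n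
  have cofactor: "E n + (\<Sum>j = 1..k - 1. b j * E (n - int j)) = 0" if "n \<ge> 1" for n
  proof -
    have "(\<Sum>j = 1..k - 1. b j * (g q k \<gamma> * \<gamma> powi (n - int j)))
        = (\<Sum>j = 1..k - 1. g q k \<gamma> * \<gamma> powi n * (b j * (1 / \<gamma>) ^ j))"
      using pos by (intro sum.cong) (auto simp: power_int_diff field_simps)
    also have "\<dots> = g q k \<gamma> * \<gamma> powi n * S" by (simp add: S_def sum_distrib_left)
    finally have *: "g q k \<gamma> * \<gamma> powi n + (\<Sum>j = 1..k - 1. b j * (g q k \<gamma> * \<gamma> powi (n - int j)))
        = g q k \<gamma> * (1 + S) * \<gamma> powi n" by (simp add: algebra_simps)
    \<comment> \<open>This is the normalization of \<open>g\<close>: the cofactor sends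
      \<open>genfib\<close> and its approximation to the same power of
      \<open>\<gamma>\<close>.\<close>
    have "g q k \<gamma> * (1 + S) * \<gamma> powi n = \<gamma> powi (n - 1)"
      using pos S_nonneg by (simp add: g_root power_int_diff)
    then show ?thesis using * genfib_cofactor[OF that]
      by (simp add: E_def right_diff_distrib sum_subtractf)
  qed
  have "\<bar>E n\<bar> \<le> 1 / real q"
  proof (induction "nat n" arbitrary: n rule: less_induct)
    case less
    show ?case
    proof (cases "n \<le> 1")
      case True
      then show ?thesis using genfib_approx_initial by (simp add: E_def)
    next
      case False
      then have n: "n \<ge> 2" by simp
      have "(\<Sum>j = 1..k - 1. b j * E (n - 1 - int j)) = (\<Sum>j = 1..k - 1. b (Suc j - 1) * E (n - int (Suc j)))"
        by (intro sum.cong) (auto simp: algebra_simps)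
      also have "\<dots> = (\<Sum>j = 2..k. b (j - 1) * E (n - int j))"
        by (rule sum_shift_two[OF k])
      finally have 1: "(\<Sum>j = 1..k - 1. b j * E (n - 1 - int j)) = (\<Sum>j = 2..k. b (j - 1) * E (n - int j))" .
      have "(\<Sum>j = 1..k - 1. b j * E (n - int j)) = (\<Sum>j = 1..k. b j * E (n - int j))"
        using k b_k by (cases k) auto
      also have "\<dots> = b 1 * E (n - 1) + (\<Sum>j = 2..k. b j * E (n - int j))"
        by (simp only: sum_split_first[OF k]) simp
      finally have 2: "(\<Sum>j = 1..k - 1. b j * E (n - int j)) =
        b 1 * E (n - 1) + (\<Sum>j = 2..k. b j * E (n - int j))" .
      \<comment> \<open>Difference of the cofactor identities at \<open>n\<close> and
        \<open>n - 1\<close>; the latter needs \<open>n \<ge> 2\<close>.\<close>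
      have "E n = (1 - b 1) * E (n - 1) + (\<Sum>j = 2..k. (b (j - 1) - b j) * E (n - int j))"
        using cofactor[of n] cofactor[of "n - 1"] n unfolding 1 2
        by (simp add: left_diff_distrib sum_subtractf)
      also have "\<bar>\<dots>\<bar> \<le> (1 - b 1) * (1 / real q) + (\<Sum>j = 2..k. (b (j - 1) - b j) * (1 / real q))"
      proof (intro order.trans[OF abs_triangle_ineq] add_mono order.trans[OF sum_abs] sum_mono)
        have "b 1 \<le> 1" by (rule order.trans[OF b_le]) (use root_gt_3 in simp)
        then show "\<bar>(1 - b 1) * E (n - 1)\<bar> \<le> (1 - b 1) * (1 / real q)"
          using n unfolding abs_mult by (intro mult_mono less) auto
        fix j assume j: "j \<in> {2..k}"
        have "b j \<le> b (j - 1)" using b_Suc_le[of "j - 1"] j by simp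
        then show "\<bar>(b (j - 1) - b j) * E (n - int j)\<bar> \<le> (b (j - 1) - b j) * (1 / real q)"
          using n j unfolding abs_mult by (intro mult_mono less) auto
      qed
      also have "\<dots> = (1 - b 1 + (\<Sum>j = 2..k. b (j - 1) - b j)) * (1 / real q)"
        by (simp only: sum_distrib_right distrib_right)
      \<comment> \<open>Since \<open>b k = 0\<close>, the weights telescope to total
        \<open>1\<close>.\<close>
      also have "(\<Sum>j = 2..k. b (j - 1) - b j) = b 1"
        using sum_telescope''[of 1 k "\<lambda>j. - b j"] k
        by (simp add: numeral_2_eq_2 b_k)
      finally show ?thesis by simp
    qed
  qed
  then show ?thesis by (simp add: E_def)
qed

end

section \<open>The Binet formula\<close>

text \<open>In the Leibniz sum every term other than that of \<open>i\<close> keeps the factor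
  vanishing at \<open>a i\<close>.\<close>

lemma pderiv_prod_linear_factors:
  fixes a :: "'i \<Rightarrow> 'a::field_char_0"
  assumes "finite A" "i \<in> A"
  shows "poly (pderiv (\<Prod>i\<in>A. [:- a i, 1:])) (a i) = (\<Prod>j\<in>A - {i}. a i - a j)"
proof -
  have "poly (pderiv (\<Prod>i\<in>A. [:- a i, 1:])) (a i) =
      (\<Sum>l\<in>A. \<Prod>j\<in>A - {l}. a i - a j)"
    by (simp add: pderiv_prod poly_sum poly_prod pderiv_pCons)
  also have "\<dots> = (\<Sum>l\<in>A. if l = i then \<Prod>j\<in>A - {i}. a i - a j else 0)"
    using assms by (intro sum.cong) auto
  also have "\<dots> = (\<Prod>j\<in>A - {i}. a i - a j)"
    using assms by simp
  finally show ?thesis .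
qed

text \<open>Compare the coefficients of degree \<open>card A - 1\<close> of \<open>x ^ m\<close> and of its Lagrange interpolation polynomial.\<close>

lemma sum_powers_over_pderiv:
  fixes a :: "'i \<Rightarrow> 'a::field_char_0"
  assumes fin: "finite A" and m: "m < card A"
    and simple: "\<And>i. i \<in> A \<Longrightarrow> poly (pderiv (\<Prod>i\<in>A. [:- a i, 1:])) (a i) \<noteq> 0"
  shows "(\<Sum>i\<in>A. a i ^ m / poly (pderiv (\<Prod>i\<in>A. [:- a i, 1:])) (a i)) =
    (if m = card A - 1 then 1 else 0)"
proof -
  define d where "d i = poly (pderiv (\<Prod>i\<in>A. [:- a i, 1:])) (a i)" for i
  define L where "L i = (\<Prod>j\<in>A - {i}. [:- a j, 1:])" for i
  have d: "d i = (\<Prod>j\<in>A - {i}. a i - a j)" if "i \<in> A" for i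
    unfolding d_def by (rule pderiv_prod_linear_factors[OF fin that])
  have d0: "d i \<noteq> 0" if "i \<in> A" for i using simple[OF that] by (simp add: d_def)
  \<comment> \<open>A repeated value would put a zero factor into \<open>d i\<close>; interpolation
    needs distinct nodes.\<close>
  have inj: "inj_on a A"
  proof (rule inj_onI, rule ccontr)
    fix i j assume "i \<in> A" "j \<in> A" "a i = a j" "i \<noteq> j"
    then show False using d0[of i] d[of i] fin by auto
  qed
  have degL: "degree (L i) = card A - 1" if "i \<in> A" for i
    unfolding L_def using that fin by (simp add: degree_prod_sum_eq)
  have coeffL: "coeff (L i) (card A - 1) = 1" if "i \<in> A" for i
    using lead_coeff_prod[of "\<lambda>j. [:- a j, 1:]" "A - {i}"] degL[OF that] by (simp add: L_def)
  have "(\<Sum>i\<in>A. smult (a i ^ m / d i) (L i)) = monom 1 m"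
  proof (rule poly_eqI_degree[of "a ` A"])
    fix x assume "x \<in> a ` A"
    then obtain l where l: "l \<in> A" "x = a l" by auto
    have "poly (\<Sum>i\<in>A. smult (a i ^ m / d i) (L i)) x =
        (\<Sum>i\<in>A. a i ^ m / d i * (\<Prod>j\<in>A - {i}. a l - a j))"
      by (simp add: poly_sum L_def poly_prod l)
    also have "\<dots> = (\<Sum>i\<in>A. if i = l then a l ^ m else 0)"
      using l fin d0[of l] d[of l] by (intro sum.cong) auto
    also have "\<dots> = poly (monom 1 m) x" using l fin by (simp add: poly_monom)
    finally show "poly (\<Sum>i\<in>A. smult (a i ^ m / d i) (L i)) x = poly (monom 1 m) x" .
  next
    have "degree (\<Sum>i\<in>A. smult (a i ^ m / d i) (L i)) \<le> card A - 1"
      using fin degL by (intro degree_sum_le) (auto intro: order.trans[OF degree_smult_le])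
    then show "degree (\<Sum>i\<in>A. smult (a i ^ m / d i) (L i)) < card (a ` A)"
      using m by (simp add: card_image[OF inj])
    show "degree (monom (1::'a) m) < card (a ` A)"
      using m by (simp add: card_image[OF inj] degree_monom_eq)
  qed
  then have "coeff (\<Sum>i\<in>A. smult (a i ^ m / d i) (L i)) (card A - 1) = coeff (monom 1 m) (card A - 1)"
    by simp
  then show ?thesis using coeffL by (simp add: coeff_sum d_def)
qed

text \<open>A nonreal root would have real part \<open>B / (2 * A)\<close> and squared modulus
  \<open>C / A\<close>, against the discriminant condition. At a nonpositive real point no term is
  negative and \<open>C\<close> is positive.\<close>

lemma quadratic_root_real_positive:
  fixes z :: complex and A B C :: real
  assumes "A > 0" "B > 0" "C > 0" and discrim: "B\<^sup>2 \<ge> 4 * A * C"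
    and root: "of_real A * z\<^sup>2 - of_real B * z + of_real C = 0"
  shows "\<exists>x > 0. z = of_real x"
proof -
  have re: "A * ((Re z)\<^sup>2 - (Im z)\<^sup>2) - B * Re z + C = 0"
    using arg_cong[OF root, of Re] by (simp add: power2_eq_square)
  have im: "Im z * (2 * A * Re z - B) = 0"
    using arg_cong[OF root, of Im] by (simp add: power2_eq_square algebra_simps)
  have "Im z = 0"
  proof (rule ccontr)
    assume nz: "Im z \<noteq> 0"
    then have B: "B = 2 * A * Re z" using im by simp
    have "A * (Re z)\<^sup>2 + A * (Im z)\<^sup>2 = C" using re unfolding B by (simp add: algebra_simps power2_eq_square)
    moreover have "A * (A * (Re z)\<^sup>2) \<ge> A * C"
      using discrim unfolding B by (simp add: power2_eq_square algebra_simps)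
    then have "A * (Re z)\<^sup>2 \<ge> C" using \<open>A > 0\<close> by simp
    moreover have "A * (Im z)\<^sup>2 > 0" using nz \<open>A > 0\<close> by simp
    ultimately show False by linarith
  qed
  moreover have "Re z > 0"
  proof (rule ccontr)
    assume "\<not> Re z > 0"
    then have "B * Re z \<le> 0" using \<open>B > 0\<close> by (simp add: mult_nonneg_nonpos)
    moreover have "A * (Re z)\<^sup>2 \<ge> 0" using \<open>A > 0\<close> by simp
    ultimately show False using re \<open>Im z = 0\<close> \<open>C > 0\<close> by simp
  qed
  ultimately show ?thesis by (intro exI[of _ "Re z"]) (simp add: complex_eq_iff)
qed

text \<open>At a multiple root the denominator of \<open>g\<close> vanishes. This quadratic has only positive real
  roots, so the multiple root would be the dominant one, where the denominator is positive.\<close>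

lemma roots_Phi_simple:
  fixes z :: complex
  assumes k: "k \<ge> 2" and q: "q \<ge> 3" and root: "poly (Phi q k) z = 0"
  shows "poly (pderiv (Phi q k)) z \<noteq> 0"
proof
  assume "poly (pderiv (Phi q k)) z = 0"
  moreover have "z \<noteq> 0" by (rule Phi_root_nonzero[OF k root])
  ultimately have "(of_nat k + 1) * z ^ 2 - (of_nat q + 1) * of_nat k * z + (of_nat q - 1) * (of_nat k - 1) = 0"
    using pderiv_Phi_at_root[OF k root] by simp
  then have quad: "of_real (real k + 1) * z\<^sup>2 - of_real ((real q + 1) * real k) * z
      + of_real ((real q - 1) * (real k - 1)) = 0" by simp
  \<comment> \<open>The discriminant condition: after bounding \<open>k^2 - 1\<close> by
    \<open>k^2\<close>, it reduces to
    \<open>(q + 1)^2 - 4 * (q - 1) = (q - 1)^2 + 4 \<ge> 0\<close>.\<close>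
  have "4 * (real k + 1) * ((real q - 1) * (real k - 1)) = 4 * (real q - 1) * ((real k)\<^sup>2 - 1)"
    by (simp add: algebra_simps power2_eq_square)
  also have "\<dots> \<le> 4 * (real q - 1) * (real k)\<^sup>2" using q by (intro mult_left_mono) auto
  also have "\<dots> \<le> (real q + 1)\<^sup>2 * (real k)\<^sup>2"
  proof (intro mult_right_mono)
    have "(real q + 1)\<^sup>2 - 4 * (real q - 1) = (real q - 1)\<^sup>2 + 4"
      by (simp add: power2_eq_square algebra_simps)
    also have "\<dots> \<ge> 0" by simp
    finally show "4 * (real q - 1) \<le> (real q + 1)\<^sup>2" by simp
  qed simp
  finally have "((real q + 1) * real k)\<^sup>2 \<ge> 4 * (real k + 1) * ((real q - 1) * (real k - 1))"
    by (simp add: power_mult_distrib)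
  then obtain x where x: "x > 0" "z = of_real x"
    using quadratic_root_real_positive[OF _ _ _ _ quad] k q by auto
  have "complex_of_real (poly (Phi q k) x) = poly (Phi q k) z"
    by (simp add: poly_Phi x)
  then have "poly (Phi q k) x = 0" using root by (simp only: of_real_eq_0_iff)
  then interpret positive_root q k x
    using k q x by unfold_locales
  have "complex_of_real ((real k + 1) * x ^ 2 - (real q + 1) * real k * x + (real q - 1) * (real k - 1)) = 0"
    using quad by (simp add: x)
  then have "x * (x - 1) * (1 + S) = 0" unfolding denominator by (simp only: of_real_eq_0_iff)
  then show False using root_gt_3 S_nonneg by simp
qed

text \<open>The sums of \<open>\<gamma>s i ^ m / d i\<close> have the initial values of the sequence
  and inherit its recurrence from the root equations; the derivative formula turns
  \<open>\<gamma>s i ^ (k - 2) / d i\<close> into \<open>g\<close>.\<close>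

lemma genfib_Binet:
  fixes \<gamma>s :: "nat \<Rightarrow> complex"
  assumes k: "k \<ge> 2" and q: "q \<ge> 3"
    and roots: "Phi q k = (\<Prod>i = 1..k. [:- \<gamma>s i, 1:])"
    and n: "n \<ge> 2 - int k"
  shows "of_int (genfib q k n) = (\<Sum>i = 1..k. g q k (\<gamma>s i) * \<gamma>s i powi n)"
proof -
  define d where "d i = poly (pderiv (Phi q k)) (\<gamma>s i)" for i
  have root: "poly (Phi q k) (\<gamma>s i) = 0" if "i \<in> {1..k}" for i
    unfolding roots poly_prod using that by (intro prod_zero) auto
  have d0: "d i \<noteq> 0" if "i \<in> {1..k}" for i
    unfolding d_def by (rule roots_Phi_simple[OF k q root[OF that]])
  have powers: "(\<Sum>i = 1..k. \<gamma>s i ^ m / d i) = (if m = k - 1 then 1 else 0)" if "m < k" for m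
    using sum_powers_over_pderiv[of "{1..k}" m \<gamma>s] d0 that unfolding d_def roots by simp
  \<comment> \<open>The shift \<open>m = n + k - 2\<close> makes the exponents natural numbers and
    puts the initial value \<open>1\<close> at \<open>m = k - 1\<close>.\<close>
  have sum_eq: "of_int (genfib q k (int m + 2 - int k)) = (\<Sum>i = 1..k. \<gamma>s i ^ m / d i)" for m
  proof (induction m rule: less_induct)
    case (less m)
    consider "m < k - 1" | "m = k - 1" | "m \<ge> k" by linarith
    then show ?case
    proof cases
      case 1
      then show ?thesis using powers[of m] by (simp add: genfib.simps)
    next
      case 2
      then show ?thesis using powers[of m] k by (simp add: genfib_1 of_nat_diff)
    next
      case 3
      let ?n = "int m + 2 - int k"
      have rec: "\<gamma>s i ^ m = of_nat q * \<gamma>s i ^ (m - 1) + (\<Sum>j = 2..k. \<gamma>s i ^ (m - j))"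
        if "i \<in> {1..k}" for i
      proof -
        have "(\<Sum>j<k - 1. \<gamma>s i ^ j) = (\<Sum>j = 2..k. \<gamma>s i ^ (k - j))"
          by (rule sum.reindex_bij_witness[of _ "\<lambda>j. k - j" "\<lambda>j. k - j"]) auto
        then have "\<gamma>s i ^ k = of_nat q * \<gamma>s i ^ (k - 1) + (\<Sum>j = 2..k. \<gamma>s i ^ (k - j))"
          using root[OF that] by (simp add: poly_Phi algebra_simps)
        then have "\<gamma>s i ^ (m - k) * \<gamma>s i ^ k = of_nat q * (\<gamma>s i ^ (m - k) * \<gamma>s i ^ (k - 1))
            + (\<Sum>j = 2..k. \<gamma>s i ^ (m - k) * \<gamma>s i ^ (k - j))"
          by (simp add: distrib_left sum_distrib_left)
        then show ?thesis using 3 k by (simp flip: power_add)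
      qed
      have "complex_of_int (genfib q k ?n) = of_nat q * of_int (genfib q k (int (m - 1) + 2 - int k))
          + (\<Sum>j = 2..k. of_int (genfib q k (int (m - j) + 2 - int k)))"
      proof -
        have "?n - 1 = int (m - 1) + 2 - int k" using 3 k by simp
        moreover have "(\<Sum>j = 2..k. genfib q k (?n - int j)) =
            (\<Sum>j = 2..k. genfib q k (int (m - j) + 2 - int k))"
          using 3 by (intro sum.cong) (auto simp: of_nat_diff algebra_simps)
        moreover have "genfib q k ?n = int q * genfib q k (?n - 1) + (\<Sum>j = 2..k. genfib q k (?n - int j))"
          using 3 by (intro genfib_rec) simp
        ultimately have "genfib q k ?n = int q * genfib q k (int (m - 1) + 2 - int k)
            + (\<Sum>j = 2..k. genfib q k (int (m - j) + 2 - int k))"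
          by (simp only:)
        then show ?thesis by (simp only: of_int_add of_int_mult of_int_sum of_int_of_nat_eq)
      qed
      also have "\<dots> = of_nat q * (\<Sum>i = 1..k. \<gamma>s i ^ (m - 1) / d i)
          + (\<Sum>j = 2..k. \<Sum>i = 1..k. \<gamma>s i ^ (m - j) / d i)"
      proof -
        have "(\<Sum>j = 2..k. complex_of_int (genfib q k (int (m - j) + 2 - int k)))
            = (\<Sum>j = 2..k. \<Sum>i = 1..k. \<gamma>s i ^ (m - j) / d i)"
          by (rule sum.cong[OF refl less.IH]) (use 3 k in auto)
        moreover have "complex_of_int (genfib q k (int (m - 1) + 2 - int k)) = (\<Sum>i = 1..k. \<gamma>s i ^ (m - 1) / d i)"
          by (rule less.IH) (use 3 k in auto)
        ultimately show ?thesis by (simp only:)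
      qed
      also have "\<dots> = (\<Sum>i = 1..k. (of_nat q * \<gamma>s i ^ (m - 1) + (\<Sum>j = 2..k. \<gamma>s i ^ (m - j))) / d i)"
      proof -
        have "(\<Sum>j = 2..k. \<Sum>i = 1..k. \<gamma>s i ^ (m - j) / d i) = (\<Sum>i = 1..k. (\<Sum>j = 2..k. \<gamma>s i ^ (m - j)) / d i)"
          unfolding sum_divide_distrib by (rule sum.swap)
        moreover have "of_nat q * (\<Sum>i = 1..k. \<gamma>s i ^ (m - 1) / d i) = (\<Sum>i = 1..k. of_nat q * \<gamma>s i ^ (m - 1) / d i)"
          by (simp only: sum_distrib_left times_divide_eq_right)
        ultimately show ?thesis by (simp only: add_divide_distrib sum.distrib)
      qed
      also have "\<dots> = (\<Sum>i = 1..k. \<gamma>s i ^ m / d i)"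
        by (rule sum.cong[OF refl]) (simp only: rec)
      finally show ?thesis .
    qed
  qed
  have summand: "g q k (\<gamma>s i) * \<gamma>s i powi n = \<gamma>s i ^ nat (n + int k - 2) / d i" if i: "i \<in> {1..k}" for i
  proof -
    define D where "D = (of_nat k + 1) * \<gamma>s i ^ 2 - (of_nat q + 1) * of_nat k * \<gamma>s i + (of_nat q - 1) * (of_nat k - 1)"
    have *: "(\<gamma>s i - 1) * d i = \<gamma>s i ^ (k - 2) * D"
      unfolding d_def D_def by (rule pderiv_Phi_at_root[OF k root[OF i]])
    \<comment> \<open>With \<open>1\<close> excluded as a root, neither side of \<open>*\<close>
      vanishes, so \<open>D\<close> is nonzero and the quotients can be cross-multiplied.\<close>
    have ne1: "\<gamma>s i \<noteq> 1"
    proof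
      assume "\<gamma>s i = 1"
      then have "of_nat q + of_nat (k - 1) = (1 :: complex)"
        using root[OF i] by (simp add: poly_Phi algebra_simps)
      then have "q + (k - 1) = 1" by (metis of_nat_add of_nat_eq_1_iff)
      then show False using q by simp
    qed
    have "\<gamma>s i ^ (k - 2) * D \<noteq> 0"
      unfolding *[symmetric] using ne1 d0[OF i] by simp
    then have D0: "D \<noteq> 0" by simp
    have ne0: "\<gamma>s i \<noteq> 0" by (rule Phi_root_nonzero[OF k root[OF i]])
    have "g q k (\<gamma>s i) = (\<gamma>s i - 1) / D" by (simp add: g_def D_def)
    also have "\<dots> = \<gamma>s i ^ (k - 2) / d i"
      unfolding frac_eq_eq[OF D0 d0[OF i]] by (rule *)
    finally have "g q k (\<gamma>s i) * \<gamma>s i powi n = \<gamma>s i powi int (k - 2) * \<gamma>s i powi n / d i" by simp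
    also have "\<dots> = \<gamma>s i powi (int (k - 2) + n) / d i" using ne0 by (simp add: power_int_add)
    also have "int (k - 2) + n = int (nat (n + int k - 2))" using n k by simp
    finally show ?thesis by (simp only: power_int_of_nat)
  qed
  have "(\<Sum>i = 1..k. g q k (\<gamma>s i) * \<gamma>s i powi n) = (\<Sum>i = 1..k. \<gamma>s i ^ nat (n + int k - 2) / d i)"
    by (rule sum.cong[OF refl summand])
  also have "\<dots> = of_int (genfib q k n)"
    using sum_eq[of "nat (n + int k - 2)"] n by simp
  finally show ?thesis by simp
qed

theorem theorem1:
  fixes q k :: nat and \<gamma>s :: "nat \<Rightarrow> complex" and \<gamma> :: real
  assumes k: "k \<ge> 2" and q: "q \<ge> 3"
    and roots: "Phi q k = (\<Prod>i = 1..k. [:- \<gamma>s i, 1:])"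
    and dominant: "\<gamma> = dominant_root q k"
  shows "(\<forall>n::int. n \<ge> 2 - int k \<longrightarrow>
           of_int (genfib q k n) = (\<Sum>i = 1..k. g q k (\<gamma>s i) * \<gamma>s i powi n)) \<and>
         (\<forall>n::int. n \<ge> 2 - int k \<longrightarrow>
           \<bar>real_of_int (genfib q k n) - g q k \<gamma> * \<gamma> powi n\<bar> \<le> 1 / real q) \<and>
         (\<forall>n::int. n \<ge> 1 \<longrightarrow>
           \<gamma> powi (n - 2) < \<gamma> powi (n - 1) * ((real q - 1) / real q) \<and>
           \<gamma> powi (n - 1) * ((real q - 1) / real q) < real_of_int (genfib q k n) \<and>
           real_of_int (genfib q k n) < \<gamma> powi (n - 1) * ((real q + 2) / real q) \<and>
           \<gamma> powi (n - 1) * ((real q + 2) / real q) < \<gamma> powi n)"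
proof -
  interpret positive_root q k \<gamma>
    using dominant_root[of k q] k q dominant by unfold_locales auto
  have "\<gamma> powi (n - 2) < \<gamma> powi (n - 1) * ((real q - 1) / real q)" for n
  proof -
    have "1 < 3 * ((real q - 1) / real q)" using q by (simp add: field_simps)
    also have "\<dots> \<le> \<gamma> * ((real q - 1) / real q)"
      using root_gt_3 q by (intro mult_right_mono) auto
    finally have "\<gamma> powi (n - 2) * 1 < \<gamma> powi (n - 2) * (\<gamma> * ((real q - 1) / real q))"
      using pos by (intro mult_strict_left_mono) auto
    moreover have "\<gamma> powi (n - 2) * \<gamma> = \<gamma> powi (n - 1)"
      using pos power_int_add_1[of \<gamma> "n - 2"] by simp
    ultimately show ?thesis by (simp add: mult.assoc[symmetric])
  qed
  moreover have "real_of_int (genfib q k n) < \<gamma> powi (n - 1) * ((real q + 2) / real q)" for n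
  proof -
    \<comment> \<open>\<open>genfib_le\<close> is an equality at \<open>n = 1\<close>; the factor
      above \<open>1\<close> makes the bound strict.\<close>
    have "\<gamma> powi (n - 1) * 1 < \<gamma> powi (n - 1) * ((real q + 2) / real q)"
      using pos q by (intro mult_strict_left_mono) auto
    then show ?thesis using genfib_le[of n] by simp
  qed
  moreover have "\<gamma> powi (n - 1) * ((real q + 2) / real q) < \<gamma> powi n" for n
  proof -
    have "(real q + 2) / real q \<le> 3" using q by (simp add: field_simps)
    then have "\<gamma> powi (n - 1) * ((real q + 2) / real q) < \<gamma> powi (n - 1) * \<gamma>"
      using pos root_gt_3 by (intro mult_strict_left_mono) auto
    also have "\<dots> = \<gamma> powi n" using pos power_int_add_1[of \<gamma> "n - 1"] by simp
    finally show ?thesis .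
  qed
  ultimately show ?thesis
    using genfib_Binet[OF k q roots] genfib_approx genfib_greater by blast
qed

end
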